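(* Let $q>1$ be real. For any $x\in\mathbb{C}^*\smallsetminus(-\infty,0)$ we have $$\mathcal{E}_q(x)=\frac1{\ln q}\int_1^q\mathcal{E}_q^{[\lambda]}(x)\,\frac{d\lambda}{\lambda}.$$
   Context: $p=q^{-1}\in(0,1)$; $[n]_q=\frac{q^n-1}{q-1}$, $[n]_q^!=[n]_q\cdots[1]_q$, $[0]_q^!=1$; $e_q(x)=\sum_{n\ge0}\frac{x^n}{[n]_q^!}=\prod_{k\ge0}(1+(1-p)p^kx)$; Jackson integral $\int_{\alpha p^{\mathbb{Z}}}f(\xi)\,d_p\xi=(1-p)\alpha\sum_{n\in\mathbb{Z}}f(p^n\alpha)p^n$. $\mathcal{E}_q$ is the function which for $d\in(-\pi,\pi)$ and $\arg x\in(d-\pi,d+\pi)$ is given by $\frac{q-1}{\ln q}\int_0^{e^{id}\infty}\frac{d\xi}{(1+\xi)e_q(q\xi/x)}$; here it is evaluated with $\arg x\in(-\pi,\pi)$ (so $d=0$ may be used). For $\lambda\in\mathbb{C}^*\smallsetminus(-q^{\mathbb{Z}})$, $\mathcal{E}_q^{[\lambda]}(x)=q\int_{\lambda p^{\mathbb{Z}}}\frac{d_p\xi}{(1+\xi)e_q(q\xi/x)}$ for $x\in\mathbb{C}^*\smallsetminus\left(-\lambda(1-p)q^{\mathbb{Z}}\right)$. *)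

theory Defs
  imports "HOL-Analysis.Analysis"
begin

definition q_bracket :: "real \<Rightarrow> nat \<Rightarrow> real" where
  "q_bracket q n = (q ^ n - 1) / (q - 1)"

definition q_fact :: "real \<Rightarrow> nat \<Rightarrow> real" where
  "q_fact q n = (\<Prod>k=1..n. q_bracket q k)"

(* For q > 1 this power series has infinite radius of convergence. *)
definition q_exp :: "real \<Rightarrow> complex \<Rightarrow> complex" where
  "q_exp q x = (\<Sum>n. x ^ n / complex_of_real (q_fact q n))"

(* Integral over the bilateral geometric progression a * p^Z. The sum over all integers is the
   unconditional one. *)
definition jackson_integral :: "real \<Rightarrow> complex \<Rightarrow> (complex \<Rightarrow> complex) \<Rightarrow> complex" where
  "jackson_integral p a f =
     (1 - complex_of_real p) * a *
       (\<Sum>\<^sub>\<infinity>n\<in>(UNIV :: int set). f (complex_of_real p powi n * a) * complex_of_real p powi n)"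

(* Integral along the half-line from 0 to e^(i d) * infinity, parametrised by t * cis d, t > 0. *)
definition ray_integral :: "real \<Rightarrow> (complex \<Rightarrow> complex) \<Rightarrow> complex" where
  "ray_integral d f = (CLBINT t=0..\<infinity>. f (complex_of_real t * cis d) * cis d)"

(* Meaningful for -pi < d < pi and arg x in (d - pi, d + pi); on this sector 1 + xi and
   e_q (q xi / x) have no zero on the half-line of integration. *)
definition q_euler_dir :: "real \<Rightarrow> real \<Rightarrow> complex \<Rightarrow> complex" where
  "q_euler_dir q d x =
     complex_of_real ((q - 1) / ln q) *
       ray_integral d (\<lambda>\<xi>. 1 / ((1 + \<xi>) * q_exp q (complex_of_real q * \<xi> / x)))"

(* The branch with arg x in (-pi, pi): there the direction d = 0 is admissible for every x. *)
definition q_euler :: "real \<Rightarrow> complex \<Rightarrow> complex" where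
  "q_euler q x = q_euler_dir q 0 x"

(* Meaningful for l nonzero and not in -q^Z, and x nonzero and not in -l (1 - 1/q) q^Z. *)
definition q_euler_jackson :: "real \<Rightarrow> complex \<Rightarrow> complex \<Rightarrow> complex" where
  "q_euler_jackson q l x =
     complex_of_real q *
       jackson_integral (inverse q) l
         (\<lambda>\<xi>. 1 / ((1 + \<xi>) * q_exp q (complex_of_real q * \<xi> / x)))"

end

theory Submission
  imports Defs "HOL-Probability.Sinc_Integral"
begin

text \<open>The half-line \<open>t > 0\<close> is the disjoint union of the intervals \<open>q\<^sup>n[1, q)\<close>, \<open>n \<in> \<int>\<close>. Rescaling each of
  them to \<open>[1, q)\<close> and exchanging sum and integral turns the integral over the half-line into the
  integral over \<open>\<lambda>\<close> of the Jackson integrals. The exchange is legitimate because the kernel is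
  absolutely integrable: \<open>q_exp q (qz) = (1 + (q - 1) z) q_exp q z\<close> shows that \<open>q_exp q\<close> has
  no zeros off the negative axis and grows at least linearly on every ray from \<open>0\<close> other than
  that axis.\<close>

section \<open>Exchange of countable sums and integrals\<close>

text \<open>For complex families summability and absolute summability coincide, so both sides make
  sense in the same cases; in all others both default to 0. Hence no summability hypothesis.\<close>

lemma infsum_eq_integral_count_space:
  fixes f :: "'i \<Rightarrow> complex"
  shows "infsum f A = integral\<^sup>L (count_space A) f"
proof (cases "f summable_on A")
  case True
  then have "Infinite_Set_Sum.abs_summable_on f A"
    by (simp add: abs_summable_equivalent summable_on_iff_abs_summable_on_complex)
  then show ?thesis
    by (simp flip: infsetsum_infsum add: infsetsum_def)
next
  case False
  then have "\<not> integrable (count_space A) f"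
    by (simp add: abs_summable_equivalent summable_on_iff_abs_summable_on_complex
          flip: Infinite_Set_Sum.abs_summable_on_def)
  then show ?thesis
    using False by (simp add: infsum_not_exists not_integrable_integral_eq)
qed

text \<open>This is Fubini for \<open>count_space A\<close> and \<open>M\<close>. Countability of
  \<open>A\<close> gives both sigma-finiteness of the counting measure and joint measurability of
  \<open>f\<close>; the hypothesis on the norms gives integrability on the product.\<close>

lemma integral_infsum:
  fixes f :: "'i \<Rightarrow> 'a \<Rightarrow> complex"
  assumes "sigma_finite_measure M" and A: "countable A"
    and f: "\<And>i. i \<in> A \<Longrightarrow> integrable M (f i)"
    and sm: "(\<lambda>i. \<integral>x. norm (f i x) \<partial>M) summable_on A"
  shows "(\<integral>x. (\<Sum>\<^sub>\<infinity>i\<in>A. f i x) \<partial>M) = (\<Sum>\<^sub>\<infinity>i\<in>A. \<integral>x. f i x \<partial>M)"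
proof -
  interpret M: sigma_finite_measure M by fact
  interpret C: sigma_finite_measure "count_space A"
    by (rule sigma_finite_measure_count_space_countable[OF A])
  interpret P: pair_sigma_finite "count_space A" M ..
  have "integrable (count_space A) (\<lambda>i. \<integral>x. norm (f i x) \<partial>M)"
    using sm by (simp flip: Infinite_Set_Sum.abs_summable_on_def abs_summable_equivalent)
  moreover have "case_prod f \<in> borel_measurable (count_space A \<Otimes>\<^sub>M M)"
    using f by (intro measurable_pair_measure_countable1[OF A]) auto
  ultimately have "integrable (count_space A \<Otimes>\<^sub>M M) (case_prod f)"
    using f by (intro P.Fubini_integrable) (auto simp: AE_count_space)
  from P.Fubini_integral[OF this] show ?thesis
    by (simp add: infsum_eq_integral_count_space)
qed

section \<open>Decomposition of the half-line along a geometric progression\<close>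

text \<open>Taking logarithms to base \<open>q\<close> turns the intervals into the unit intervals
  \<open>[-n, -n + 1)\<close>, which tile the line. The minus sign comes from using powers of
  \<open>inverse q\<close>.\<close>

lemma powi_interval_iff:
  fixes q t :: real and n :: int
  assumes "1 < q" "0 < t"
  shows "t \<in> {inverse q powi n ..< inverse q powi n * q} \<longleftrightarrow> n = - \<lfloor>log q t\<rfloor>"
proof -
  have *: "inverse q powi n = q powr of_int (- n)"
    using assms by (simp add: powr_minus powr_real_of_int' power_int_inverse)
  have **: "inverse q powi n * q = q powr (of_int (- n) + 1)"
    using assms unfolding * powr_add by simp
  have "t \<in> {inverse q powi n ..< inverse q powi n * q}
      \<longleftrightarrow> of_int (- n) \<le> log q t \<and> log q t < of_int (- n) + 1"
    unfolding ** unfolding * using assms by (simp add: le_log_iff log_less_iff)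
  also have "\<dots> \<longleftrightarrow> \<lfloor>log q t\<rfloor> = - n"
    by (simp add: floor_eq_iff)
  finally show ?thesis by auto
qed

text \<open>The factor \<open>inverse q powi n\<close> is the Jacobian of the rescaling; it
  reappears as the weight in \<open>jackson_integral\<close>.\<close>

lemma set_integral_Ioi_eq_integral_infsum:
  fixes F :: "real \<Rightarrow> complex" and q :: real
  assumes q: "1 < q" and F: "set_integrable lborel {0<..} F"
  shows "(LINT t:{0<..}|lborel. F t) =
    (LINT l:{1..<q}|lborel. \<Sum>\<^sub>\<infinity>n\<in>(UNIV :: int set).
       (inverse q powi n) *\<^sub>R F (inverse q powi n * l))"
proof -
  define p where "p n = inverse q powi n" for n :: int
  have p: "p n > 0" for n
    using q by (simp add: p_def)
  define A where "A n = {p n ..< p n * q}" for n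
  define G where "G t = indicator {0<..} t *\<^sub>R F t" for t
  define g where "g n t = indicator (A n) t *\<^sub>R F t" for n t
  define f where "f n l = indicator {1..<q} l *\<^sub>R (p n *\<^sub>R F (p n * l))" for n l
  have G: "integrable lborel G"
    using F by (simp add: G_def[abs_def] set_integrable_def)
  have g: "integrable lborel (g n)" for n
  proof -
    have "A n \<subseteq> {0<..}"
      using p[of n] by (auto simp: A_def)
    then have "set_integrable lborel (A n) F"
      by (intro set_integrable_subset[OF F]) (auto simp: A_def)
    then show ?thesis
      by (simp add: g_def[abs_def] set_integrable_def)
  qed
  \<comment> \<open>At each \<open>t\<close> at most one piece survives. For
    \<open>t \<le> 0\<close> both \<open>g n t\<close> and \<open>G t\<close> vanish, so the value
    of \<open>log\<close> there is irrelevant.\<close>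
  have g_eq: "g n t = (if n = - \<lfloor>log q t\<rfloor> then G t else 0)" for n t
  proof (cases "t > 0")
    case True
    then show ?thesis
      using powi_interval_iff[OF q True, of n] by (auto simp: g_def G_def A_def p_def)
  next
    case False
    then have "t \<notin> A n"
      using p[of n] by (auto simp: A_def)
    then show ?thesis
      using False by (simp add: g_def G_def)
  qed
  have G_eq: "G t = (\<Sum>\<^sub>\<infinity>n\<in>UNIV. g n t)" for t
    unfolding g_eq by (intro infsumI[symmetric] has_sum_finite_neutralI[of "{- \<lfloor>log q t\<rfloor>}"]) auto
  \<comment> \<open>The summand \<open>0 +\<close> gives the argument the shape required by the
    affine substitution rules for \<open>lborel\<close>.\<close>
  have f_eq: "f n l = p n *\<^sub>R g n (0 + p n * l)" for n l
    using p[of n] by (simp add: f_def g_def A_def indicator_def mult.commute)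
  have f: "integrable lborel (f n)" for n
    unfolding f_eq using p[of n] g[of n]
    by (intro integrable_scaleR_right lborel_integrable_real_affine) auto
  have int_f: "(\<integral>l. f n l \<partial>lborel) = (\<integral>t. g n t \<partial>lborel)" for n
    using p[of n] lborel_integral_real_affine[of "p n" "g n" 0] by (simp add: f_eq)
  have int_norm_f: "(\<integral>l. norm (f n l) \<partial>lborel) = (\<integral>t. norm (g n t) \<partial>lborel)" for n
    using p[of n] lborel_integral_real_affine[of "p n" "\<lambda>t. norm (g n t)" 0]
    by (simp add: f_eq)
  \<comment> \<open>Disjointness of the pieces bounds all finite sums of norms by one integral. As
    the rescaled pieces \<open>f n\<close> have the same norm integrals, this justifies both
    exchanges below.\<close>
  have "(\<Sum>n\<in>N. \<integral>t. norm (g n t) \<partial>lborel) \<le> (\<integral>t. norm (G t) \<partial>lborel)" if "finite N" for N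
  proof -
    have le: "(\<Sum>n\<in>N. norm (g n t)) \<le> norm (G t)" for t
    proof -
      have "norm (g n t) = (if n = - \<lfloor>log q t\<rfloor> then norm (G t) else 0)" for n
        by (simp add: g_eq)
      then show ?thesis
        using that by (simp add: sum.delta')
    qed
    have "(\<Sum>n\<in>N. \<integral>t. norm (g n t) \<partial>lborel) = (\<integral>t. (\<Sum>n\<in>N. norm (g n t)) \<partial>lborel)"
      using g by (subst Bochner_Integration.integral_sum) auto
    also have "\<dots> \<le> (\<integral>t. norm (G t) \<partial>lborel)"
      using g G le by (intro integral_mono) auto
    finally show ?thesis .
  qed
  then have sm: "(\<lambda>n. \<integral>t. norm (g n t) \<partial>lborel) summable_on UNIV"
    by (intro nonneg_bdd_above_summable_on) (auto intro!: bdd_aboveI)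
  have "(LINT t:{0<..}|lborel. F t) = (\<integral>t. (\<Sum>\<^sub>\<infinity>n\<in>UNIV. g n t) \<partial>lborel)"
    by (simp add: set_lebesgue_integral_def flip: G_eq G_def)
  also have "\<dots> = (\<Sum>\<^sub>\<infinity>n\<in>UNIV. \<integral>t. g n t \<partial>lborel)"
    using g sm by (intro integral_infsum lborel.sigma_finite_measure_axioms) auto
  also have "\<dots> = (\<integral>l. (\<Sum>\<^sub>\<infinity>n\<in>UNIV. f n l) \<partial>lborel)"
    unfolding int_f[symmetric] using f sm
    by (intro integral_infsum[symmetric] lborel.sigma_finite_measure_axioms) (auto simp: int_norm_f)
  also have "\<dots> = (LINT l:{1..<q}|lborel. \<Sum>\<^sub>\<infinity>n\<in>UNIV. p n *\<^sub>R F (p n * l))"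
    unfolding set_lebesgue_integral_def f_def infsum_scaleR_right ..
  finally show ?thesis
    by (simp add: p_def)
qed

section \<open>The power series of \<open>q_exp\<close> and its functional equation\<close>

lemma q_bracket_ge: "1 < q \<Longrightarrow> real n \<le> q_bracket q n"
proof -
  assume q: "1 < q"
  have "real n = (\<Sum>i<n. 1)" by simp
  also have "\<dots> \<le> (\<Sum>i<n. q ^ i)"
    using q by (intro sum_mono) auto
  also have "\<dots> = q_bracket q n"
    using q by (simp add: q_bracket_def geometric_sum)
  finally show ?thesis .
qed

lemma q_fact_0 [simp]: "q_fact q 0 = 1"
  by (simp add: q_fact_def)

lemma q_fact_Suc: "q_fact q (Suc n) = q_bracket q (Suc n) * q_fact q n"
  by (simp add: q_fact_def)

text \<open>This comparison lets the exponential series dominate that of \<open>q_exp\<close>, which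
  therefore converges everywhere.\<close>

lemma q_fact_ge_fact: "1 < q \<Longrightarrow> fact n \<le> q_fact q n"
proof (induction n)
  case (Suc n)
  then show ?case
    unfolding q_fact_Suc fact_Suc using q_bracket_ge[of q "Suc n"]
    by (intro mult_mono) auto
qed simp

lemma q_fact_pos: "1 < q \<Longrightarrow> 0 < q_fact q n"
  using q_fact_ge_fact[of q n] fact_gt_zero[of n, where 'a = real] by linarith

lemma summable_q_exp:
  assumes "1 < q"
  shows "summable (\<lambda>n. inverse (complex_of_real (q_fact q n)) * z ^ n)"
proof (rule summable_comparison_test')
  show "summable (\<lambda>n. inverse (fact n) * norm z ^ n)"
    by (rule summable_exp)
  show "norm (inverse (complex_of_real (q_fact q n)) * z ^ n) \<le> inverse (fact n) * norm z ^ n"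
    for n
    using q_fact_ge_fact[OF assms, of n] q_fact_pos[OF assms, of n]
    by (auto simp: norm_mult norm_inverse norm_power intro!: mult_right_mono le_imp_inverse_le)
qed

text \<open>The form coefficient times power is the one that the library results on power series
  expect.\<close>

lemma q_exp_altdef:
  "q_exp q = (\<lambda>z. \<Sum>n. inverse (complex_of_real (q_fact q n)) * z ^ n)"
  by (simp add: q_exp_def fun_eq_iff field_simps)

lemma isCont_q_exp: "1 < q \<Longrightarrow> isCont (q_exp q) z"
  unfolding q_exp_altdef by (intro isCont_powser_converges_everywhere summable_q_exp)

lemma continuous_on_q_exp [continuous_intros]:
  assumes "1 < q" "continuous_on S f"
  shows "continuous_on S (\<lambda>x. q_exp q (f x))"
  using assms continuous_on_compose2[of UNIV "q_exp q" S f]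
  by (auto simp: continuous_at_imp_continuous_on isCont_q_exp)

lemma q_exp_0 [simp]: "q_exp q 0 = 1"
  unfolding q_exp_altdef using powser_zero[of "\<lambda>n. inverse (complex_of_real (q_fact q n))"] by simp

text \<open>Equivalently, \<open>q_exp q\<close> is its own \<open>q\<close>-derivative. On
  coefficients this is the identity
  \<open>q ^ Suc n - 1 = (q - 1) * q_bracket q (Suc n)\<close>.\<close>

lemma q_exp_mult:
  assumes q: "1 < q"
  shows "q_exp q (of_real q * z) = (1 + of_real (q - 1) * z) * q_exp q z"
proof -
  define a where "a n = inverse (complex_of_real (q_fact q n))" for n
  note sm = summable_q_exp[OF q, folded a_def]
  have a_Suc: "of_real q ^ Suc n * a (Suc n) = a (Suc n) + of_real (q - 1) * a n" for n
  proof -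
    have "q ^ Suc n * inverse (q_fact q (Suc n))
        = inverse (q_fact q (Suc n)) + (q - 1) * inverse (q_fact q n)"
      using q q_fact_pos[OF q, of n] q_fact_pos[OF q, of "Suc n"] one_less_power[OF q, of "Suc n"]
      by (simp add: q_fact_Suc q_bracket_def divide_simps) (simp add: algebra_simps)
    then have "complex_of_real (q ^ Suc n * inverse (q_fact q (Suc n)))
        = of_real (inverse (q_fact q (Suc n)) + (q - 1) * inverse (q_fact q n))"
      by (rule arg_cong)
    then show ?thesis by (simp add: a_def)
  qed
  have sm_Suc: "summable (\<lambda>n. a (Suc n) * z ^ Suc n)"
    using sm[of z] by (subst summable_Suc_iff)
  have "q_exp q (of_real q * z) = a 0 + (\<Sum>n. a (Suc n) * (of_real q * z) ^ Suc n)"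
    unfolding q_exp_altdef a_def[symmetric] using suminf_split_head[OF sm[of "of_real q * z"]]
    by simp
  also have "(\<lambda>n. a (Suc n) * (of_real q * z) ^ Suc n)
      = (\<lambda>n. a (Suc n) * z ^ Suc n + of_real (q - 1) * z * (a n * z ^ n))"
  proof
    fix n
    have "a (Suc n) * (of_real q * z) ^ Suc n = (of_real q ^ Suc n * a (Suc n)) * z ^ Suc n"
      by (simp add: power_mult_distrib mult_ac)
    also have "\<dots> = a (Suc n) * z ^ Suc n + of_real (q - 1) * z * (a n * z ^ n)"
      unfolding a_Suc by (simp add: algebra_simps)
    finally show "a (Suc n) * (of_real q * z) ^ Suc n
      = a (Suc n) * z ^ Suc n + of_real (q - 1) * z * (a n * z ^ n)" .
  qed
  also have "a 0 + (\<Sum>n. a (Suc n) * z ^ Suc n + of_real (q - 1) * z * (a n * z ^ n))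
      = (a 0 + (\<Sum>n. a (Suc n) * z ^ Suc n)) + of_real (q - 1) * z * (\<Sum>n. a n * z ^ n)"
    using sm[of z] sm_Suc
    by (subst suminf_add[symmetric]) (auto intro!: summable_mult simp: suminf_mult)
  also have "a 0 + (\<Sum>n. a (Suc n) * z ^ Suc n) = q_exp q z"
    unfolding q_exp_altdef a_def[symmetric] using suminf_split_head[OF sm[of z]] by simp
  also have "(\<Sum>n. a n * z ^ n) = q_exp q z"
    unfolding q_exp_altdef a_def ..
  finally show ?thesis by (simp add: algebra_simps)
qed

section \<open>Zeros and growth of \<open>q_exp\<close>\<close>

text \<open>The factor \<open>1 + (q - 1) * w\<close> in the functional equation vanishes only at a
  negative real \<open>w\<close>, so a zero at \<open>z\<close> would descend to all
  \<open>z / q ^ n\<close>. These points tend to 0, where the value is 1, contradicting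
  continuity.\<close>

lemma q_exp_nonzero:
  assumes q: "1 < q" and z: "z \<notin> complex_of_real ` {..<0}"
  shows "q_exp q z \<noteq> 0"
proof
  assume zero: "q_exp q z = 0"
  define w where "w n = of_real (inverse q ^ n) * z" for n
  have "q_exp q (w n) = 0" for n
  proof (induction n)
    case (Suc n)
    have w: "w n = of_real q * w (Suc n)"
      using q by (simp add: w_def)
    have "1 + of_real (q - 1) * w (Suc n) \<noteq> 0"
    proof
      assume *: "1 + of_real (q - 1) * w (Suc n) = 0"
      define c where "c = (q - 1) * inverse q ^ Suc n"
      have c: "c > 0" using q by (simp add: c_def)
      have "of_real c * z = - 1"
        using * by (simp add: w_def c_def add_eq_0_iff mult.assoc)
      then have "z = of_real (- 1 / c)"
        using c by (simp add: field_simps)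
      moreover have "- 1 / c < 0" using c by simp
      ultimately show False using z by blast
    qed
    with Suc.IH q_exp_mult[OF q, of "w (Suc n)"] show ?case
      by (simp add: w)
  qed (simp add: zero w_def)
  moreover have "w \<longlonglongrightarrow> of_real 0 * z"
    unfolding w_def using q by (intro tendsto_intros LIMSEQ_realpow_zero) (auto simp: inverse_less_1_iff)
  then have "(\<lambda>n. q_exp q (w n)) \<longlonglongrightarrow> q_exp q 0"
    using isCont_tendsto_compose[OF isCont_q_exp[OF q], of w "of_real 0 * z"] by simp
  ultimately show False
    by (simp add: LIMSEQ_const_iff)
qed

text \<open>Far out, the functional equation makes \<open>\<bar>q_exp q z\<bar>\<close> grow by a factor of at least \<open>q\<close>
  whenever \<open>z\<close> is multiplied by \<open>q\<close>, so that a bound on a compact segment propagates along the ray.\<close>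

lemma q_exp_ray_lower_bound:
  fixes u :: complex
  assumes q: "1 < q" and u: "u \<noteq> 0" "u \<notin> complex_of_real ` {..<0}"
  obtains m where "0 < m" "\<And>t. 0 \<le> t \<Longrightarrow> m * (1 + t) \<le> norm (q_exp q (of_real t * u))"
proof -
  define e where "e t = norm (q_exp q (of_real t * u))" for t
  \<comment> \<open>For \<open>t \<ge> T\<close> this makes \<open>(q - 1) * t * norm u\<close> at
    least \<open>q + 1\<close>, so the factor in the functional equation has norm at least
    \<open>q\<close>.\<close>
  define T where "T = (q + 1) / ((q - 1) * norm u)"
  have T: "T > 0" using q u by (simp add: T_def)
  have ray: "of_real t * u \<notin> complex_of_real ` {..<0}" if "0 \<le> t" for t
  proof (cases "t = 0")
    case False
    show ?thesis
    proof
      assume "of_real t * u \<in> complex_of_real ` {..<0}"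
      then obtain s where "of_real t * u = complex_of_real s" "s < 0" by auto
      then have "u = of_real (s / t)" "s / t < 0"
        using False that by (auto simp: field_simps)
      with u show False by blast
    qed
  qed auto
  \<comment> \<open>The segment reaches up to \<open>q * T\<close> because beyond it
    \<open>t / q\<close> still exceeds \<open>T\<close>, where the growth step applies.\<close>
  have cont: "continuous_on {0..q * T} e"
    unfolding e_def using q by (intro continuous_intros)
  obtain s where s: "s \<in> {0..q * T}" and min: "\<And>t. t \<in> {0..q * T} \<Longrightarrow> e s \<le> e t"
    using continuous_attains_inf[OF _ _ cont] q T by auto
  have es: "e s > 0"
    using q_exp_nonzero[OF q ray] s by (simp add: e_def)
  define m where "m = e s / (1 + q * T)"
  have m: "m > 0" using es q T by (simp add: m_def add_pos_pos)
  have step: "q * e t \<le> e (q * t)" if "T \<le> t" for t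
  proof -
    have "q + 1 = (q - 1) * T * norm u"
      using q u by (simp add: T_def)
    also have "\<dots> \<le> (q - 1) * t * norm u"
      using that q by (intro mult_right_mono mult_left_mono) auto
    also have "\<dots> = norm (of_real (q - 1) * (of_real t * u))"
      using q T that by (simp only: norm_mult norm_of_real abs_of_pos)
    also have "\<dots> \<le> norm (1 + of_real (q - 1) * (of_real t * u)) + 1"
      using norm_triangle_ineq4[of "1 + of_real (q - 1) * (of_real t * u)" 1] by simp
    finally have "q \<le> norm (1 + of_real (q - 1) * (of_real t * u))" by simp
    then have "q * e t \<le> norm (1 + of_real (q - 1) * (of_real t * u)) * e t"
      by (intro mult_right_mono) (auto simp: e_def)
    also have "\<dots> = e (q * t)"
      using q_exp_mult[OF q, of "of_real t * u"] by (simp add: e_def norm_mult mult.assoc)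
    finally show ?thesis .
  qed
  have bound: "m * (1 + t) \<le> e t" if "0 \<le> t" "t \<le> q ^ n * (q * T)" for t n
    using that
  proof (induction n arbitrary: t)
    case 0
    then have "m * (1 + t) \<le> m * (1 + q * T)"
      using m by (intro mult_left_mono) auto
    also have "\<dots> = e s"
      using add_pos_pos[of 1 "q * T"] q T by (simp add: m_def)
    also have "\<dots> \<le> e t" using 0 by (intro min) auto
    finally show ?case .
  next
    case (Suc n)
    show ?case
    proof (cases "t \<le> q * T")
      case True
      with Suc.prems show ?thesis
        using m min[of t] mult_left_mono[of "1 + t" "1 + q * T" m] add_pos_pos[of 1 "q * T"] q T
        by (simp add: m_def)
    next
      case False
      \<comment> \<open>Since \<open>q + t = q * (1 + t / q)\<close>, the induction hypothesis at
        \<open>t / q\<close> can be multiplied by \<open>q\<close>.\<close>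
      have "m * (1 + t) \<le> m * (q + t)"
        using m q by (intro mult_left_mono) auto
      also have "\<dots> = q * (m * (1 + t / q))"
        using q by (simp add: field_simps)
      also have "\<dots> \<le> q * e (t / q)"
        using Suc.prems q by (intro mult_left_mono Suc.IH) (auto simp: field_simps)
      also have "\<dots> \<le> e (q * (t / q))"
        using False q by (intro step) (auto simp: field_simps)
      finally show ?thesis using q by simp
    qed
  qed
  have "m * (1 + t) \<le> e t" if "0 \<le> t" for t
  proof -
    obtain n where "t / (q * T) < q ^ n"
      using real_arch_pow[OF q] by blast
    then show ?thesis
      using that q T by (intro bound[of t n]) (auto simp: field_simps)
  qed
  with m show ?thesis using that unfolding e_def by blast
qed

section \<open>Integrability of the kernel and the averaging formula\<close>

text \<open>With \<open>u = q / x\<close> off the negative axis, \<open>q_exp\<close> contributes a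
  linear lower bound and \<open>1 + t\<close> another, so the denominator is at least
  \<open>m * (1 + t)^2 \<ge> m * (1 + t^2)\<close>. The arctangent integrand is thus a
  majorant.\<close>

lemma set_integrable_q_euler_kernel:
  fixes x :: complex
  assumes q: "1 < q" and x: "x \<noteq> 0" "x \<notin> complex_of_real ` {..<0}"
  shows "set_integrable lborel {0<..}
    (\<lambda>t. 1 / ((1 + complex_of_real t) * q_exp q (of_real q * of_real t / x)))"
proof -
  define u where "u = of_real q / x"
  have u0: "u \<noteq> 0" using q x by (simp add: u_def)
  have u1: "u \<notin> complex_of_real ` {..<0}"
  proof
    assume "u \<in> complex_of_real ` {..<0}"
    then obtain s where s: "u = of_real s" "s < 0" by auto
    then have "x = of_real (q / s)" using x q by (auto simp: u_def field_simps)
    moreover have "q / s < 0" using s q by (simp add: divide_pos_neg)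
    ultimately show False using x by blast
  qed
  obtain m where m: "0 < m" "\<And>t. 0 \<le> t \<Longrightarrow> m * (1 + t) \<le> norm (q_exp q (of_real t * u))"
    using q_exp_ray_lower_bound[OF q u0 u1] by blast
  have eq: "of_real q * of_real t / x = of_real t * u" for t
    by (simp add: u_def)
  have [measurable]: "(\<lambda>t. q_exp q (of_real t * u)) \<in> borel_measurable borel"
    using q by (intro borel_measurable_continuous_onI continuous_intros)
  have "set_integrable lborel {0<..} (\<lambda>t::real. 1 / (1 + t\<^sup>2))"
    using integrable_I0i_1_div_plus_square by (simp add: interval_lebesgue_integral_0_infty)
  then have int: "set_integrable lborel {0<..} (\<lambda>t::real. inverse m * (1 / (1 + t\<^sup>2)))"
    by (rule set_integrable_mult_right)
  show ?thesis
    unfolding eq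
  proof (rule set_integrable_bound[OF int])
    show "AE t in lborel. t \<in> {0<..} \<longrightarrow>
      norm (1 / ((1 + complex_of_real t) * q_exp q (of_real t * u)))
        \<le> norm (inverse m * (1 / (1 + t\<^sup>2)))"
    proof (intro AE_I2 impI)
      fix t :: real
      assume "t \<in> {0<..}"
      then have t: "t > 0" by simp
      have n1: "norm (1 + complex_of_real t) = 1 + t"
        using t by (metis add_pos_pos norm_of_real abs_of_pos of_real_1 of_real_add zero_less_one)
      have "m * (1 + t\<^sup>2) \<le> (1 + t) * (m * (1 + t))"
        using m(1) t by (simp add: algebra_simps power2_eq_square)
      also have "\<dots> \<le> (1 + t) * norm (q_exp q (of_real t * u))"
        using m(2)[of t] t by (intro mult_left_mono) auto
      finally have "inverse ((1 + t) * norm (q_exp q (of_real t * u))) \<le> inverse (m * (1 + t\<^sup>2))"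
        using m(1) by (intro le_imp_inverse_le) (auto intro!: mult_pos_pos add_pos_nonneg)
      then show "norm (1 / ((1 + complex_of_real t) * q_exp q (of_real t * u)))
        \<le> norm (inverse m * (1 / (1 + t\<^sup>2)))"
        using m(1) by (simp add: norm_mult norm_inverse n1 divide_inverse)
    qed
  qed (auto simp: set_borel_measurable_def)
qed

theorem theorem3p10:
  fixes q :: real and x :: complex
  assumes "q > 1"
    and "x \<noteq> 0"
    and "x \<notin> complex_of_real ` {..<0}"
  shows "q_euler q x =
    complex_of_real (1 / ln q) *
      (CLBINT l=1..q. q_euler_jackson q (complex_of_real l) x / complex_of_real l)"
proof -
  define F where
    "F t = 1 / ((1 + complex_of_real t) * q_exp q (of_real q * of_real t / x))" for t
  define S where
    "S l = (\<Sum>\<^sub>\<infinity>n\<in>(UNIV :: int set). (inverse q powi n) *\<^sub>R F (inverse q powi n * l))" for l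
  have F: "set_integrable lborel {0<..} F"
    unfolding F_def using assms by (rule set_integrable_q_euler_kernel)
  \<comment> \<open>The prefactor \<open>l\<close> of the Jackson integral cancels the denominator
    of \<open>d\<lambda> / \<lambda>\<close>, and \<open>q * (1 - p) = q - 1\<close> for
    \<open>p = inverse q\<close>.\<close>
  have jackson: "q_euler_jackson q (of_real l) x / of_real l = of_real (q - 1) * S l"
    if "l \<in> {1..<q}" for l
  proof -
    have "complex_of_real q * (1 - complex_of_real (inverse q)) = of_real (q - 1)"
      using assms(1) by (simp add: field_simps)
    moreover have "(\<Sum>\<^sub>\<infinity>n\<in>(UNIV :: int set).
        1 / ((1 + of_real (inverse q) powi n * of_real l) *
          q_exp q (of_real q * (of_real (inverse q) powi n * of_real l) / x)) *
        of_real (inverse q) powi n) = S l"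
      unfolding S_def F_def by (intro infsum_cong) (simp add: scaleR_conv_of_real)
    ultimately show ?thesis
      using that by (simp add: q_euler_jackson_def jackson_integral_def flip: mult.assoc)
  qed
  \<comment> \<open>Adding the endpoint 1 changes no integral and gives the half-open interval whose
    rescalings tile the half-line.\<close>
  have "(CLBINT l=1..q. q_euler_jackson q (of_real l) x / of_real l)
      = (LINT l:{1..<q}|lborel. q_euler_jackson q (of_real l) x / of_real l)"
    using assms(1) interval_integral_Ico[of 1 q] by (simp add: one_ereal_def)
  also have "\<dots> = (LINT l:{1..<q}|lborel. of_real (q - 1) * S l)"
    by (intro set_lebesgue_integral_cong) (auto simp: jackson)
  also have "\<dots> = of_real (q - 1) * (LINT t:{0<..}|lborel. F t)"
    unfolding set_integral_Ioi_eq_integral_infsum[OF assms(1) F] S_def[symmetric]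
    by (rule set_integral_mult_right)
  finally show ?thesis
    by (simp add: q_euler_def q_euler_dir_def ray_integral_def
        interval_lebesgue_integral_0_infty F_def)
qed

end
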